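(* Let $L$ be a distributive lattice whose underlying type lives in universe level $\ell$, let $B\subseteq L$ be a basis of $L$, let $C$ be an $\ell$-complete category, and let $\mathcal{G}:B^{op}\to C$ be a sheaf on the basis $B$. Then the right Kan extension $\mathrm{Ran}\,\mathcal{G}:L^{op}\to C$ is a sheaf on the distributive lattice $L$.
   Context: The setting is univalent foundations. A distributive lattice is regarded as a poset category. A basis of $L$ is a subset $B\subseteq L$ containing $\top$, closed under binary meets, such that every $x\in L$ merely is a finite join of elements of $B$; $B$ is regarded as a full sub-poset of $L$. $C$ is $\ell$-complete if it has limits of all diagrams indexed by categories in universe level $\ell$. For a presheaf $\mathcal{H}$ (on $L$ or $B$) and a finite list $\alpha=[\alpha_1,\dots,\alpha_n]$, the $\mathcal{H}$-diagram associated to $\alpha$ has objects $\mathcal{H}(\alpha_i)$ ($1\le i\le n$) and $\mathcal{H}(\alpha_i\wedge\alpha_j)$ ($1\le i<j\le n$) with restriction maps $\mathcal{H}(\alpha_i)\to\mathcal{H}(\alpha_i\wedge\alpha_j)\leftarrow\mathcal{H}(\alpha_j)$. A presheaf $\mathcal{F}:L^{op}\to C$ is a sheaf on $L$ if for every finite list $\alpha$ in $L$ (including the empty list, with join $\bot$) the cone with vertex $\mathcal{F}(\bigvee_i\alpha_i)$ given by restriction maps is a limiting cone over the $\mathcal{F}$-diagram associated to $\alpha$. A presheaf $\mathcal{G}:B^{op}\to C$ is a sheaf on the basis $B$ if the same holds for every finite list $\alpha$ in $B$ with $\bigvee_i\alpha_i\in B$. $\mathrm{Ran}\,\mathcal{G}$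 is the pointwise right Kan extension along $B\hookrightarrow L$: $(\mathrm{Ran}\,\mathcal{G})(x)=\varprojlim\{\mathcal{G}(u)\to\mathcal{G}(v)\mid u,v\in B,\ v\le u\le x\}$. *)

theory Defs
  imports Main
begin

text \<open>
  Categories are given by hom-sets indexed by pairs of objects, so every operation carries its
  source and target objects; \<open>Comp C x y z g f\<close> is the composite \<open>g \<circ> f\<close> of
  \<open>f \<in> Hom C x y\<close> and \<open>g \<in> Hom C y z\<close>. Distinct hom-sets need not be disjoint.
\<close>

record ('o, 'm) cat =
  Ob :: "'o set"
  Hom :: "'o \<Rightarrow> 'o \<Rightarrow> 'm set"
  Ident :: "'o \<Rightarrow> 'm"
  Comp :: "'o \<Rightarrow> 'o \<Rightarrow> 'o \<Rightarrow> 'm \<Rightarrow> 'm \<Rightarrow> 'm"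

definition category :: "('o, 'm) cat \<Rightarrow> bool" where
  "category C \<longleftrightarrow>
    (\<forall>x\<in>Ob C. Ident C x \<in> Hom C x x) \<and>
    (\<forall>x\<in>Ob C. \<forall>y\<in>Ob C. \<forall>z\<in>Ob C. \<forall>f\<in>Hom C x y. \<forall>g\<in>Hom C y z.
      Comp C x y z g f \<in> Hom C x z) \<and>
    (\<forall>x\<in>Ob C. \<forall>y\<in>Ob C. \<forall>f\<in>Hom C x y.
      Comp C x x y f (Ident C x) = f \<and> Comp C x y y (Ident C y) f = f) \<and>
    (\<forall>w\<in>Ob C. \<forall>x\<in>Ob C. \<forall>y\<in>Ob C. \<forall>z\<in>Ob C. \<forall>f\<in>Hom C w x. \<forall>g\<in>Hom C x y. \<forall>h\<in>Hom C y z.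
      Comp C w x z (Comp C x y z h g) f = Comp C w y z h (Comp C w x y g f))"

definition op_cat :: "('o, 'm) cat \<Rightarrow> ('o, 'm) cat" where
  "op_cat C = \<lparr>Ob = Ob C, Hom = (\<lambda>x y. Hom C y x), Ident = Ident C,
    Comp = (\<lambda>x y z g f. Comp C z y x f g)\<rparr>"

definition poset_cat :: "'a::order set \<Rightarrow> ('a, unit) cat" where
  "poset_cat A = \<lparr>Ob = A, Hom = (\<lambda>x y. if x \<le> y then {()} else {}),
    Ident = (\<lambda>x. ()), Comp = (\<lambda>x y z g f. ())\<rparr>"

record ('o, 'm, 'p, 'n) cfunctor =
  omap :: "'o \<Rightarrow> 'p"
  mmap :: "'o \<Rightarrow> 'o \<Rightarrow> 'm \<Rightarrow> 'n"

definition is_functor :: "('o, 'm) cat \<Rightarrow> ('p, 'n) cat \<Rightarrow> ('o, 'm, 'p, 'n) cfunctor \<Rightarrow> bool" where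
  "is_functor J C F \<longleftrightarrow>
    (\<forall>x\<in>Ob J. omap F x \<in> Ob C) \<and>
    (\<forall>x\<in>Ob J. \<forall>y\<in>Ob J. \<forall>f\<in>Hom J x y. mmap F x y f \<in> Hom C (omap F x) (omap F y)) \<and>
    (\<forall>x\<in>Ob J. mmap F x x (Ident J x) = Ident C (omap F x)) \<and>
    (\<forall>x\<in>Ob J. \<forall>y\<in>Ob J. \<forall>z\<in>Ob J. \<forall>f\<in>Hom J x y. \<forall>g\<in>Hom J y z.
      mmap F x z (Comp J x y z g f) =
        Comp C (omap F x) (omap F y) (omap F z) (mmap F y z g) (mmap F x y f))"

definition is_cone :: "('j, 'k) cat \<Rightarrow> ('o, 'm) cat \<Rightarrow> ('j, 'k, 'o, 'm) cfunctor \<Rightarrow>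
    'o \<Rightarrow> ('j \<Rightarrow> 'm) \<Rightarrow> bool" where
  "is_cone J C D c l \<longleftrightarrow>
    c \<in> Ob C \<and>
    (\<forall>i\<in>Ob J. l i \<in> Hom C c (omap D i)) \<and>
    (\<forall>i\<in>Ob J. \<forall>j\<in>Ob J. \<forall>f\<in>Hom J i j.
      Comp C c (omap D i) (omap D j) (mmap D i j f) (l i) = l j)"

definition is_limit_cone :: "('j, 'k) cat \<Rightarrow> ('o, 'm) cat \<Rightarrow> ('j, 'k, 'o, 'm) cfunctor \<Rightarrow>
    'o \<Rightarrow> ('j \<Rightarrow> 'm) \<Rightarrow> bool" where
  "is_limit_cone J C D c l \<longleftrightarrow>
    is_cone J C D c l \<and>
    (\<forall>c' l'. is_cone J C D c' l' \<longrightarrow>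
      (\<exists>!h. h \<in> Hom C c' c \<and> (\<forall>i\<in>Ob J. Comp C c' c (omap D i) (l i) h = l' i)))"

text \<open>
  The type \<open>'u\<close> plays the role of a universe level: a category lives in it if its objects and the
  elements of its hom-sets are elements of \<open>'u\<close>.
\<close>

definition complete_category :: "'u itself \<Rightarrow> ('o, 'm) cat \<Rightarrow> bool" where
  "complete_category U C \<longleftrightarrow>
    (\<forall>(J :: ('u, 'u) cat) (D :: ('u, 'u, 'o, 'm) cfunctor).
      category J \<longrightarrow> is_functor J C D \<longrightarrow> (\<exists>c l. is_limit_cone J C D c l))"

definition list_join :: "'l::bounded_lattice list \<Rightarrow> 'l" where
  "list_join \<alpha> = foldr sup \<alpha> bot"

definition lattice_basis :: "'l::{distrib_lattice, bounded_lattice} set \<Rightarrow> bool" where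
  "lattice_basis B \<longleftrightarrow>
    top \<in> B \<and>
    (\<forall>x\<in>B. \<forall>y\<in>B. inf x y \<in> B) \<and>
    (\<forall>x. \<exists>\<alpha>. set \<alpha> \<subseteq> B \<and> x = list_join \<alpha>)"

definition presheaf :: "('o, 'm) cat \<Rightarrow> 'l::order set \<Rightarrow> ('l, unit, 'o, 'm) cfunctor \<Rightarrow> bool" where
  "presheaf C A F \<longleftrightarrow> is_functor (op_cat (poset_cat A)) C F"

text \<open>
  Shape of the diagram of a list of length \<open>n\<close> (list positions count from \<open>0\<close>). Its only
  non-identity arrows are \<open>Single i \<rightarrow> Overlap i j \<leftarrow> Single j\<close> for \<open>i < j < n\<close>.
\<close>

datatype sheaf_obj = Single nat | Overlap nat nat

definition sheaf_shape :: "nat \<Rightarrow> (sheaf_obj, unit) cat" where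
  "sheaf_shape n = \<lparr>
    Ob = {Single i | i. i < n} \<union> {Overlap i j | i j. i < j \<and> j < n},
    Hom = (\<lambda>p q. if p = q \<or> (\<exists>i j. q = Overlap i j \<and> (p = Single i \<or> p = Single j))
      then {()} else {}),
    Ident = (\<lambda>p. ()),
    Comp = (\<lambda>p q r g f. ())\<rparr>"

fun sheaf_elem :: "'l::lattice list \<Rightarrow> sheaf_obj \<Rightarrow> 'l" where
  "sheaf_elem \<alpha> (Single i) = \<alpha> ! i"
| "sheaf_elem \<alpha> (Overlap i j) = inf (\<alpha> ! i) (\<alpha> ! j)"

definition sheaf_diagram :: "('l::lattice, unit, 'o, 'm) cfunctor \<Rightarrow> 'l list \<Rightarrow>
    (sheaf_obj, unit, 'o, 'm) cfunctor" where
  "sheaf_diagram H \<alpha> = \<lparr>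
    omap = (\<lambda>p. omap H (sheaf_elem \<alpha> p)),
    mmap = (\<lambda>p q f. mmap H (sheaf_elem \<alpha> p) (sheaf_elem \<alpha> q) ())\<rparr>"

definition sheaf_on :: "('o, 'm) cat \<Rightarrow> 'l::bounded_lattice set \<Rightarrow>
    ('l, unit, 'o, 'm) cfunctor \<Rightarrow> bool" where
  "sheaf_on C A F \<longleftrightarrow>
    presheaf C A F \<and>
    (\<forall>\<alpha>. set \<alpha> \<subseteq> A \<longrightarrow> list_join \<alpha> \<in> A \<longrightarrow>
      is_limit_cone (sheaf_shape (length \<alpha>)) C (sheaf_diagram F \<alpha>)
        (omap F (list_join \<alpha>)) (\<lambda>p. mmap F (list_join \<alpha>) (sheaf_elem \<alpha> p) ()))"

definition sheaf_on_basis :: "('o, 'm) cat \<Rightarrow> 'l::{distrib_lattice, bounded_lattice} set \<Rightarrow>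
    ('l, unit, 'o, 'm) cfunctor \<Rightarrow> bool" where
  "sheaf_on_basis C B G \<longleftrightarrow> sheaf_on C B G"

definition sheaf_on_lattice :: "('o, 'm) cat \<Rightarrow>
    ('l::{distrib_lattice, bounded_lattice}, unit, 'o, 'm) cfunctor \<Rightarrow> bool" where
  "sheaf_on_lattice C F \<longleftrightarrow> sheaf_on C UNIV F"

definition ran_shape :: "'l::order set \<Rightarrow> 'l \<Rightarrow> ('l, unit) cat" where
  "ran_shape B x = op_cat (poset_cat {u \<in> B. u \<le> x})"

text \<open>A chosen limit cone (vertex and legs) over \<open>{G u \<rightarrow> G v | u, v \<in> B, v \<le> u \<le> x}\<close>.\<close>

definition ran_cone :: "('o, 'm) cat \<Rightarrow> 'l::order set \<Rightarrow> ('l, unit, 'o, 'm) cfunctor \<Rightarrow>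
    'l \<Rightarrow> 'o \<times> ('l \<Rightarrow> 'm)" where
  "ran_cone C B G x = (SOME (c, l). is_limit_cone (ran_shape B x) C G c l)"

definition Ran :: "('o, 'm) cat \<Rightarrow> 'l::order set \<Rightarrow> ('l, unit, 'o, 'm) cfunctor \<Rightarrow>
    ('l, unit, 'o, 'm) cfunctor" where
  "Ran C B G = \<lparr>
    omap = (\<lambda>x. fst (ran_cone C B G x)),
    mmap = (\<lambda>x y f. THE h.
      h \<in> Hom C (fst (ran_cone C B G x)) (fst (ran_cone C B G y)) \<and>
      (\<forall>v\<in>{v \<in> B. v \<le> y}.
        Comp C (fst (ran_cone C B G x)) (fst (ran_cone C B G y)) (omap G v)
          (snd (ran_cone C B G y) v) h = snd (ran_cone C B G x) v))\<rparr>"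

end

theory Submission
  imports Defs
begin

text \<open>
  A morphism from \<open>c\<close> into \<open>Ran G x\<close> is the same thing as a compatible family of morphisms
  \<open>c \<rightarrow> G v\<close> for \<open>v\<close> in \<open>B\<close> below \<open>x\<close>. A cone over the \<open>Ran G\<close>-diagram of \<open>\<alpha>\<close> with vertex \<open>c\<close>
  is therefore a compatible family indexed by the basis elements lying below some entry of \<open>\<alpha>\<close>.
  By distributivity every basis element \<open>u\<close> below \<open>\<Or>\<alpha>\<close> is a finite join of such elements, so the
  sheaf property of \<open>G\<close> extends the family uniquely to all basis elements below \<open>\<Or>\<alpha>\<close>. The
  extension does not depend on the chosen covers, because its value at \<open>u\<close> is characterised by its
  restrictions to all indices below \<open>u\<close>.
\<close>

section \<open>Joins of lists\<close>

lemma list_join_le_iff: "list_join \<alpha> \<le> y \<longleftrightarrow> (\<forall>a\<in>set \<alpha>. a \<le> y)"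
  unfolding list_join_def by (induction \<alpha>) auto

lemma list_join_upper: "a \<in> set \<alpha> \<Longrightarrow> a \<le> list_join \<alpha>"
  using list_join_le_iff by blast

lemma inf_list_join:
  fixes u :: "'l::{distrib_lattice, bounded_lattice}"
  shows "inf u (list_join \<alpha>) = list_join (map (inf u) \<alpha>)"
  unfolding list_join_def by (induction \<alpha>) (auto simp: inf_sup_distrib1)

lemma lattice_basis_inf: "lattice_basis B \<Longrightarrow> u \<in> B \<Longrightarrow> v \<in> B \<Longrightarrow> inf u v \<in> B"
  unfolding lattice_basis_def by blast

lemma lattice_basis_refine_cover:
  fixes B :: "'l::{distrib_lattice, bounded_lattice} set"
  assumes B: "lattice_basis B" and u: "u \<in> B" "u \<le> list_join \<alpha>"
  obtains \<gamma> where "set \<gamma> \<subseteq> {v \<in> B. \<exists>a\<in>set \<alpha>. v \<le> a}" "list_join \<gamma> = u"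
proof -
  have "\<forall>x. \<exists>\<beta>. set \<beta> \<subseteq> B \<and> x = list_join \<beta>"
    using B unfolding lattice_basis_def by blast
  then obtain \<beta> where \<beta>: "set (\<beta> x) \<subseteq> B" "list_join (\<beta> x) = x" for x
    by metis
  define \<delta> where "\<delta> = concat (map \<beta> \<alpha>)"
  have below: "d \<in> B \<and> (\<exists>a\<in>set \<alpha>. d \<le> a)" if d: "d \<in> set \<delta>" for d
  proof -
    obtain a where "a \<in> set \<alpha>" "d \<in> set (\<beta> a)"
      using d unfolding \<delta>_def by auto
    then show ?thesis
      using \<beta>(1)[of a] \<beta>(2)[of a] list_join_upper[of d "\<beta> a"] by auto
  qed
  have "a \<le> list_join \<delta>" if "a \<in> set \<alpha>" for a
  proof -
    have "set (\<beta> a) \<subseteq> set \<delta>"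
      using that unfolding \<delta>_def by auto
    then have "list_join (\<beta> a) \<le> list_join \<delta>"
      unfolding list_join_le_iff using list_join_upper by blast
    then show ?thesis by (simp add: \<beta>(2))
  qed
  then have "list_join \<alpha> \<le> list_join \<delta>"
    by (simp add: list_join_le_iff)
  with u(2) have "u \<le> list_join \<delta>"
    by (rule order_trans)
  then have "list_join (map (inf u) \<delta>) = u"
    by (simp add: inf_list_join[symmetric] inf.absorb1)
  moreover have "inf u d \<in> B \<and> (\<exists>a\<in>set \<alpha>. inf u d \<le> a)" if "d \<in> set \<delta>" for d
    using below[OF that] lattice_basis_inf[OF B u(1), of d] le_infI2[of d _ u] by blast
  then have "set (map (inf u) \<delta>) \<subseteq> {v \<in> B. \<exists>a\<in>set \<alpha>. v \<le> a}"
    by auto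
  ultimately show thesis using that by blast
qed

section \<open>Category laws\<close>

lemma category_ident_in: "category C \<Longrightarrow> x \<in> Ob C \<Longrightarrow> Ident C x \<in> Hom C x x"
  unfolding category_def by blast

lemma category_ident_left:
  "category C \<Longrightarrow> x \<in> Ob C \<Longrightarrow> y \<in> Ob C \<Longrightarrow> f \<in> Hom C x y \<Longrightarrow>
    Comp C x y y (Ident C y) f = f"
  unfolding category_def by blast

lemma category_ident_right:
  "category C \<Longrightarrow> x \<in> Ob C \<Longrightarrow> y \<in> Ob C \<Longrightarrow> f \<in> Hom C x y \<Longrightarrow>
    Comp C x x y f (Ident C x) = f"
  unfolding category_def by blast

lemma category_comp_in:
  "category C \<Longrightarrow> x \<in> Ob C \<Longrightarrow> y \<in> Ob C \<Longrightarrow> z \<in> Ob C \<Longrightarrow>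
    f \<in> Hom C x y \<Longrightarrow> g \<in> Hom C y z \<Longrightarrow> Comp C x y z g f \<in> Hom C x z"
  unfolding category_def by blast

lemma category_assoc:
  "category C \<Longrightarrow> w \<in> Ob C \<Longrightarrow> x \<in> Ob C \<Longrightarrow> y \<in> Ob C \<Longrightarrow> z \<in> Ob C \<Longrightarrow>
    f \<in> Hom C w x \<Longrightarrow> g \<in> Hom C x y \<Longrightarrow> h \<in> Hom C y z \<Longrightarrow>
    Comp C w x z (Comp C x y z h g) f = Comp C w y z h (Comp C w x y g f)"
  unfolding category_def by blast

section \<open>Cones over diagrams indexed by posets\<close>

lemma is_cone_op_poset_iff:
  "is_cone (op_cat (poset_cat A)) C G c k \<longleftrightarrow>
    c \<in> Ob C \<and> (\<forall>v\<in>A. k v \<in> Hom C c (omap G v)) \<and>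
    (\<forall>u\<in>A. \<forall>v\<in>A. v \<le> u \<longrightarrow> Comp C c (omap G u) (omap G v) (mmap G u v ()) (k u) = k v)"
  unfolding is_cone_def op_cat_def poset_cat_def by auto

lemma is_cone_op_poset_subset:
  "is_cone (op_cat (poset_cat A)) C G c k \<Longrightarrow> A' \<subseteq> A \<Longrightarrow> is_cone (op_cat (poset_cat A')) C G c k"
  unfolding is_cone_op_poset_iff by (meson subsetD)

lemma is_limit_cone_op_poset_iff:
  "is_limit_cone (op_cat (poset_cat A)) C G c l \<longleftrightarrow>
    is_cone (op_cat (poset_cat A)) C G c l \<and>
    (\<forall>c' l'. is_cone (op_cat (poset_cat A)) C G c' l' \<longrightarrow>
      (\<exists>!h. h \<in> Hom C c' c \<and> (\<forall>v\<in>A. Comp C c' c (omap G v) (l v) h = l' v)))"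
  unfolding is_limit_cone_def by (simp add: op_cat_def poset_cat_def)

lemma presheaf_iff:
  "presheaf C A F \<longleftrightarrow>
    (\<forall>x\<in>A. omap F x \<in> Ob C) \<and>
    (\<forall>x\<in>A. \<forall>y\<in>A. y \<le> x \<longrightarrow> mmap F x y () \<in> Hom C (omap F x) (omap F y)) \<and>
    (\<forall>x\<in>A. mmap F x x () = Ident C (omap F x)) \<and>
    (\<forall>x\<in>A. \<forall>y\<in>A. \<forall>z\<in>A. y \<le> x \<longrightarrow> z \<le> y \<longrightarrow>
      mmap F x z () =
        Comp C (omap F x) (omap F y) (omap F z) (mmap F y z ()) (mmap F x y ()))"
  unfolding presheaf_def is_functor_def op_cat_def poset_cat_def by auto

lemma presheaf_omap_in: "presheaf C A F \<Longrightarrow> x \<in> A \<Longrightarrow> omap F x \<in> Ob C"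
  unfolding presheaf_iff by meson

lemma presheaf_mmap_in:
  "presheaf C A F \<Longrightarrow> x \<in> A \<Longrightarrow> y \<in> A \<Longrightarrow> y \<le> x \<Longrightarrow>
    mmap F x y () \<in> Hom C (omap F x) (omap F y)"
  unfolding presheaf_iff by meson

lemma presheaf_mmap_refl: "presheaf C A F \<Longrightarrow> x \<in> A \<Longrightarrow> mmap F x x () = Ident C (omap F x)"
  unfolding presheaf_iff by meson

lemma presheaf_mmap_trans:
  "presheaf C A F \<Longrightarrow> x \<in> A \<Longrightarrow> y \<in> A \<Longrightarrow> z \<in> A \<Longrightarrow> y \<le> x \<Longrightarrow> z \<le> y \<Longrightarrow>
    mmap F x z () = Comp C (omap F x) (omap F y) (omap F z) (mmap F y z ()) (mmap F x y ())"
  unfolding presheaf_iff by meson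

lemma presheaf_subset: "presheaf C A F \<Longrightarrow> A' \<subseteq> A \<Longrightarrow> presheaf C A' F"
  unfolding presheaf_iff by (meson subsetD)

lemma ball_Ob_sheaf_shape:
  "(\<forall>p\<in>Ob (sheaf_shape n). P p) \<longleftrightarrow>
    (\<forall>i<n. P (Single i)) \<and> (\<forall>i j. i < j \<longrightarrow> j < n \<longrightarrow> P (Overlap i j))"
  unfolding sheaf_shape_def by auto

lemma is_cone_sheaf_diagram_iff:
  assumes F: "presheaf C A F" and "category C"
    and \<alpha>: "set \<alpha> \<subseteq> A" "\<And>u v. u \<in> A \<Longrightarrow> v \<in> A \<Longrightarrow> inf u v \<in> A"
  shows "is_cone (sheaf_shape (length \<alpha>)) C (sheaf_diagram F \<alpha>) c l \<longleftrightarrow>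
    c \<in> Ob C \<and>
    (\<forall>i<length \<alpha>. l (Single i) \<in> Hom C c (omap F (\<alpha> ! i))) \<and>
    (\<forall>i j. i < j \<longrightarrow> j < length \<alpha> \<longrightarrow>
      Comp C c (omap F (\<alpha> ! i)) (omap F (inf (\<alpha> ! i) (\<alpha> ! j)))
        (mmap F (\<alpha> ! i) (inf (\<alpha> ! i) (\<alpha> ! j)) ()) (l (Single i)) = l (Overlap i j) \<and>
      Comp C c (omap F (\<alpha> ! j)) (omap F (inf (\<alpha> ! i) (\<alpha> ! j)))
        (mmap F (\<alpha> ! j) (inf (\<alpha> ! i) (\<alpha> ! j)) ()) (l (Single j)) = l (Overlap i j))"
  (is "?cone \<longleftrightarrow> ?rhs")
proof
  show ?rhs if ?cone
    using that unfolding is_cone_def ball_Ob_sheaf_shape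
    by (auto simp: sheaf_shape_def sheaf_diagram_def)
next
  assume R: ?rhs
  have Ain: "\<alpha> ! i \<in> A" if "i < length \<alpha>" for i
    using that \<alpha>(1) by auto
  note Fob = presheaf_omap_in[OF F] and Fm = presheaf_mmap_in[OF F]
    and Fid = presheaf_mmap_refl[OF F]
  have O: "l (Overlap i j) \<in> Hom C c (omap F (inf (\<alpha> ! i) (\<alpha> ! j)))"
    if "i < j" "j < length \<alpha>" for i j
  proof -
    have "Comp C c (omap F (\<alpha> ! i)) (omap F (inf (\<alpha> ! i) (\<alpha> ! j)))
        (mmap F (\<alpha> ! i) (inf (\<alpha> ! i) (\<alpha> ! j)) ()) (l (Single i))
        \<in> Hom C c (omap F (inf (\<alpha> ! i) (\<alpha> ! j)))"
      using R that by (intro category_comp_in[OF \<open>category C\<close>] Fob Fm Ain \<alpha>(2)) auto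
    then show ?thesis using R that by auto
  qed
  have id: "Comp C c (omap F x) (omap F x) (mmap F x x ()) f = f"
    if "x \<in> A" "f \<in> Hom C c (omap F x)" for x f
    using that R Fob[of x] by (simp add: Fid category_ident_left[OF \<open>category C\<close>])
  have idS: "Comp C c (omap F (\<alpha> ! i)) (omap F (\<alpha> ! i)) (mmap F (\<alpha> ! i) (\<alpha> ! i) ())
      (l (Single i)) = l (Single i)" if "i < length \<alpha>" for i
    using R that by (intro id Ain) auto
  have idO: "Comp C c (omap F (inf (\<alpha> ! i) (\<alpha> ! j))) (omap F (inf (\<alpha> ! i) (\<alpha> ! j)))
      (mmap F (inf (\<alpha> ! i) (\<alpha> ! j)) (inf (\<alpha> ! i) (\<alpha> ! j)) ()) (l (Overlap i j)) = l (Overlap i j)"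
    if "i < j" "j < length \<alpha>" for i j
    using that by (intro id Ain \<alpha>(2) O) auto
  show ?cone
    unfolding is_cone_def ball_Ob_sheaf_shape
    using R O idS idO
    by (auto simp: sheaf_shape_def sheaf_diagram_def)
qed

text \<open>
  Completeness only concerns diagrams living in \<open>'u\<close>, so a diagram indexed by elements of the
  lattice is transported along the injection \<open>e\<close> first.
\<close>

lemma complete_category_op_poset_limit:
  fixes C :: "('o, 'm) cat" and e :: "'l::order \<Rightarrow> 'u"
    and G :: "('l, unit, 'o, 'm) cfunctor"
  assumes e: "inj e" and C: "complete_category TYPE('u) C" and G: "presheaf C A G"
  shows "\<exists>c l. is_limit_cone (op_cat (poset_cat A)) C G c l"
proof -
  define d where "d = the_inv e"
  have d [simp]: "d (e x) = x" for x
    unfolding d_def using e by (rule the_inv_f_f)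
  define J :: "('u, 'u) cat" where
    "J = \<lparr>Ob = e ` A, Hom = (\<lambda>a b. if d b \<le> d a then {undefined} else {}),
      Ident = (\<lambda>a. undefined), Comp = (\<lambda>x y z g f. undefined)\<rparr>"
  define D :: "('u, 'u, 'o, 'm) cfunctor" where
    "D = \<lparr>omap = (\<lambda>a. omap G (d a)), mmap = (\<lambda>a b f. mmap G (d a) (d b) ())\<rparr>"
  have "category J"
    unfolding category_def J_def by (auto split: if_splits)
  moreover have "is_functor J C D"
    unfolding is_functor_def J_def D_def
    by (auto split: if_splits intro: presheaf_omap_in[OF G] presheaf_mmap_in[OF G]
      presheaf_mmap_refl[OF G] presheaf_mmap_trans[OF G])
  ultimately obtain c m where lim: "is_limit_cone J C D c m"
    using C unfolding complete_category_def by blast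
  have cone: "is_cone J C D c' l' \<longleftrightarrow> is_cone (op_cat (poset_cat A)) C G c' (l' \<circ> e)" for c' l'
    unfolding is_cone_op_poset_iff by (auto simp: is_cone_def J_def D_def)
  have "is_limit_cone (op_cat (poset_cat A)) C G c (m \<circ> e)"
    unfolding is_limit_cone_op_poset_iff
  proof (intro conjI allI impI)
    show "is_cone (op_cat (poset_cat A)) C G c (m \<circ> e)"
      using lim cone unfolding is_limit_cone_def by blast
  next
    fix c' l'
    assume "is_cone (op_cat (poset_cat A)) C G c' l'"
    then have "is_cone J C D c' (l' \<circ> d)"
      unfolding cone by (simp add: comp_def)
    then have "\<exists>!h. h \<in> Hom C c' c \<and> (\<forall>i\<in>Ob J. Comp C c' c (omap D i) (m i) h = (l' \<circ> d) i)"
      using lim unfolding is_limit_cone_def by blast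
    then show "\<exists>!h. h \<in> Hom C c' c \<and>
        (\<forall>v\<in>A. Comp C c' c (omap G v) ((m \<circ> e) v) h = l' v)"
      by (simp add: J_def D_def)
  qed
  then show ?thesis by blast
qed

section \<open>Extending compatible families\<close>

locale basis_sheaf =
  fixes C :: "('o, 'm) cat"
    and B :: "'l::{distrib_lattice, bounded_lattice} set"
    and G :: "('l, unit, 'o, 'm) cfunctor"
  assumes category: "category C"
    and basis: "lattice_basis B"
    and sheaf: "sheaf_on C B G"
    and limits: "\<exists>c l. is_limit_cone (ran_shape B x) C G c l"
begin

abbreviation family :: "'l set \<Rightarrow> 'o \<Rightarrow> ('l \<Rightarrow> 'm) \<Rightarrow> bool" where
  "family A c k \<equiv> is_cone (op_cat (poset_cat A)) C G c k"

abbreviation below :: "'l \<Rightarrow> 'l set" where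
  "below x \<equiv> {u \<in> B. u \<le> x}"

definition restr :: "'o \<Rightarrow> 'l \<Rightarrow> 'l \<Rightarrow> 'm \<Rightarrow> 'm" where
  "restr c u v f = Comp C c (omap G u) (omap G v) (mmap G u v ()) f"

lemmas comp_in = category_comp_in[OF category] and comp_assoc = category_assoc[OF category]

lemma presheaf: "presheaf C B G"
  using sheaf unfolding sheaf_on_def by blast

lemmas omap_in = presheaf_omap_in[OF presheaf] and mmap_in = presheaf_mmap_in[OF presheaf]

lemma restr_in:
  "c \<in> Ob C \<Longrightarrow> u \<in> B \<Longrightarrow> v \<in> B \<Longrightarrow> v \<le> u \<Longrightarrow> f \<in> Hom C c (omap G u) \<Longrightarrow>
    restr c u v f \<in> Hom C c (omap G v)"
  unfolding restr_def by (intro comp_in omap_in mmap_in)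

lemma restr_restr:
  assumes "c \<in> Ob C" "u \<in> B" "v \<in> B" "w \<in> B" "v \<le> u" "w \<le> v" "f \<in> Hom C c (omap G u)"
  shows "restr c v w (restr c u v f) = restr c u w f"
proof -
  have "mmap G u w () =
      Comp C (omap G u) (omap G v) (omap G w) (mmap G v w ()) (mmap G u v ())"
    using assms by (intro presheaf_mmap_trans[OF presheaf])
  then show ?thesis
    unfolding restr_def using assms by (simp add: comp_assoc omap_in mmap_in)
qed

lemma family_iff:
  "family A c k \<longleftrightarrow>
    c \<in> Ob C \<and> (\<forall>v\<in>A. k v \<in> Hom C c (omap G v)) \<and>
    (\<forall>u\<in>A. \<forall>v\<in>A. v \<le> u \<longrightarrow> restr c u v (k u) = k v)"
  unfolding is_cone_op_poset_iff restr_def ..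

lemma family_ob: "family A c k \<Longrightarrow> c \<in> Ob C"
  unfolding family_iff by simp

lemma family_in: "family A c k \<Longrightarrow> v \<in> A \<Longrightarrow> k v \<in> Hom C c (omap G v)"
  unfolding family_iff by simp

lemma family_restr:
  "family A c k \<Longrightarrow> u \<in> A \<Longrightarrow> v \<in> A \<Longrightarrow> v \<le> u \<Longrightarrow> restr c u v (k u) = k v"
  unfolding family_iff by simp

lemma family_glue_on_cover:
  assumes "c \<in> Ob C" and \<gamma>: "set \<gamma> \<subseteq> A" "list_join \<gamma> \<in> B"
    and A: "A \<subseteq> B" "\<And>u v. u \<in> A \<Longrightarrow> v \<in> B \<Longrightarrow> v \<le> u \<Longrightarrow> v \<in> A"
    and k: "family A c k"
  shows "\<exists>!f. f \<in> Hom C c (omap G (list_join \<gamma>)) \<and>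
    (\<forall>v\<in>set \<gamma>. restr c (list_join \<gamma>) v f = k v)"
proof -
  let ?u = "list_join \<gamma>"
  have A\<gamma>: "\<gamma> ! i \<in> A" "\<gamma> ! i \<in> B" "\<gamma> ! i \<le> ?u" if "i < length \<gamma>" for i
    using subsetD[OF \<gamma>(1) nth_mem[OF that]] A(1) list_join_upper[OF nth_mem[OF that]] by blast+
  have Ainf: "inf (\<gamma> ! i) (\<gamma> ! j) \<in> A" if "i < length \<gamma>" "j < length \<gamma>" for i j
    using that by (metis A(2) A\<gamma>(1,2) lattice_basis_inf[OF basis] inf_le1)
  have cone: "is_cone (sheaf_shape (length \<gamma>)) C (sheaf_diagram G \<gamma>) c
      (\<lambda>p. k (sheaf_elem \<gamma> p))"
  proof (subst is_cone_sheaf_diagram_iff[OF presheaf category])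
    show "c \<in> Ob C \<and>
      (\<forall>i<length \<gamma>. k (sheaf_elem \<gamma> (Single i)) \<in> Hom C c (omap G (\<gamma> ! i))) \<and>
      (\<forall>i j. i < j \<longrightarrow> j < length \<gamma> \<longrightarrow>
        Comp C c (omap G (\<gamma> ! i)) (omap G (inf (\<gamma> ! i) (\<gamma> ! j)))
          (mmap G (\<gamma> ! i) (inf (\<gamma> ! i) (\<gamma> ! j)) ()) (k (sheaf_elem \<gamma> (Single i))) =
          k (sheaf_elem \<gamma> (Overlap i j)) \<and>
        Comp C c (omap G (\<gamma> ! j)) (omap G (inf (\<gamma> ! i) (\<gamma> ! j)))
          (mmap G (\<gamma> ! j) (inf (\<gamma> ! i) (\<gamma> ! j)) ()) (k (sheaf_elem \<gamma> (Single j))) =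
          k (sheaf_elem \<gamma> (Overlap i j)))"
      using \<open>c \<in> Ob C\<close> family_in[OF k] family_restr[OF k, unfolded restr_def]
      by (simp add: A\<gamma>(1) Ainf)
  qed (use \<gamma>(1) A(1) lattice_basis_inf[OF basis] in auto)
  have "is_limit_cone (sheaf_shape (length \<gamma>)) C (sheaf_diagram G \<gamma>)
        (omap G ?u) (\<lambda>p. mmap G ?u (sheaf_elem \<gamma> p) ())"
    using sheaf \<gamma> A(1) unfolding sheaf_on_def by blast
  then have ex1: "\<exists>!f. f \<in> Hom C c (omap G ?u) \<and>
      (\<forall>p\<in>Ob (sheaf_shape (length \<gamma>)). restr c ?u (sheaf_elem \<gamma> p) f = k (sheaf_elem \<gamma> p))"
    using cone unfolding is_limit_cone_def restr_def by (simp add: sheaf_diagram_def)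
  have "(\<forall>p\<in>Ob (sheaf_shape (length \<gamma>)). restr c ?u (sheaf_elem \<gamma> p) f = k (sheaf_elem \<gamma> p))
      \<longleftrightarrow> (\<forall>v\<in>set \<gamma>. restr c ?u v f = k v)" (is "?L \<longleftrightarrow> ?R")
    if f: "f \<in> Hom C c (omap G ?u)" for f
  proof
    show ?R if ?L
      using that unfolding ball_Ob_sheaf_shape by (auto simp: in_set_conv_nth)
    show ?L if R: ?R
      unfolding ball_Ob_sheaf_shape
    proof (intro conjI allI impI)
      show "restr c ?u (sheaf_elem \<gamma> (Single i)) f = k (sheaf_elem \<gamma> (Single i))"
        if "i < length \<gamma>" for i
        using R that by simp
      fix i j assume ij: "i < j" "j < length \<gamma>"
      let ?w = "inf (\<gamma> ! i) (\<gamma> ! j)"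
      have "restr c ?u ?w f = restr c (\<gamma> ! i) ?w (restr c ?u (\<gamma> ! i) f)"
        using ij f A\<gamma> Ainf[of i j] A(1) \<gamma>(2) \<open>c \<in> Ob C\<close>
        by (intro restr_restr[symmetric]) auto
      also have "\<dots> = restr c (\<gamma> ! i) ?w (k (\<gamma> ! i))"
        using R ij by simp
      also have "\<dots> = k ?w"
        using family_restr[OF k A\<gamma>(1)[of i] Ainf[of i j]] ij by simp
      finally show "restr c ?u (sheaf_elem \<gamma> (Overlap i j)) f = k (sheaf_elem \<gamma> (Overlap i j))"
        by simp
    qed
  qed
  with ex1 show ?thesis by (metis (no_types, lifting))
qed

lemma separated:
  assumes "c \<in> Ob C" and \<gamma>: "set \<gamma> \<subseteq> B" "list_join \<gamma> = u" and "u \<in> B"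
    and f: "f \<in> Hom C c (omap G u)" and g: "g \<in> Hom C c (omap G u)"
    and eq: "\<And>v. v \<in> set \<gamma> \<Longrightarrow> restr c u v f = restr c u v g"
  shows "f = g"
proof -
  have "family (below u) c (\<lambda>v. restr c u v g)"
    unfolding family_iff using assms by (auto intro: restr_in restr_restr)
  then have "\<exists>!h. h \<in> Hom C c (omap G (list_join \<gamma>)) \<and>
      (\<forall>v\<in>set \<gamma>. restr c (list_join \<gamma>) v h = restr c u v g)"
    using assms(1-4) list_join_upper[of _ \<gamma>]
    by (intro family_glue_on_cover[where A = "below u"]) auto
  then show ?thesis using f g eq \<gamma>(2) by (metis (no_types, lifting))
qed

definition sieve :: "'l list \<Rightarrow> 'l set" where
  "sieve \<alpha> = {v \<in> B. \<exists>a\<in>set \<alpha>. v \<le> a}"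

lemma sieve_down: "u \<in> sieve \<alpha> \<Longrightarrow> v \<in> B \<Longrightarrow> v \<le> u \<Longrightarrow> v \<in> sieve \<alpha>"
  unfolding sieve_def by (auto intro: order_trans)

lemma sieve_below: "sieve \<alpha> \<subseteq> below (list_join \<alpha>)"
  unfolding sieve_def by (auto intro: order_trans list_join_upper)

lemma sieve_separated:
  assumes "c \<in> Ob C" and u: "u \<in> below (list_join \<alpha>)"
    and "f \<in> Hom C c (omap G u)" "g \<in> Hom C c (omap G u)"
    and eq: "\<And>v. v \<in> sieve \<alpha> \<Longrightarrow> v \<le> u \<Longrightarrow> restr c u v f = restr c u v g"
  shows "f = g"
proof -
  obtain \<gamma> where \<gamma>: "set \<gamma> \<subseteq> sieve \<alpha>" "list_join \<gamma> = u"
    using lattice_basis_refine_cover[OF basis, of u \<alpha>] u unfolding sieve_def by blast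
  show ?thesis
  proof (rule separated[OF assms(1) _ \<gamma>(2) _ assms(3,4)])
    show "set \<gamma> \<subseteq> B" using \<gamma>(1) unfolding sieve_def by auto
    show "u \<in> B" using u by simp
    show "restr c u v f = restr c u v g" if "v \<in> set \<gamma>" for v
      using eq[of v] subsetD[OF \<gamma>(1) that] list_join_upper[OF that] \<gamma>(2) by simp
  qed
qed

lemma sieve_glue:
  assumes k: "family (sieve \<alpha>) c k" and u: "u \<in> below (list_join \<alpha>)"
  shows "\<exists>f. f \<in> Hom C c (omap G u) \<and> (\<forall>v\<in>sieve \<alpha>. v \<le> u \<longrightarrow> restr c u v f = k v)"
proof -
  note c = family_ob[OF k]
  obtain \<gamma> where \<gamma>: "set \<gamma> \<subseteq> sieve \<alpha>" "list_join \<gamma> = u"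
    using lattice_basis_refine_cover[OF basis, of u \<alpha>] u unfolding sieve_def by blast
  have sB: "v \<in> B" if "v \<in> sieve \<alpha>" for v
    using that sieve_below by blast
  have "\<exists>!f. f \<in> Hom C c (omap G (list_join \<gamma>)) \<and>
      (\<forall>v\<in>set \<gamma>. restr c (list_join \<gamma>) v f = k v)"
  proof (rule family_glue_on_cover[OF c \<gamma>(1) _ _ _ k])
    show "list_join \<gamma> \<in> B" using \<gamma>(2) u by simp
    show "sieve \<alpha> \<subseteq> B" using sB by auto
  qed (rule sieve_down)
  then obtain f where f: "f \<in> Hom C c (omap G u)" "\<And>v. v \<in> set \<gamma> \<Longrightarrow> restr c u v f = k v"
    unfolding \<gamma>(2) by blast
  have "restr c u v f = k v" if v: "v \<in> sieve \<alpha>" "v \<le> u" for v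
  proof (rule separated[of c "map (inf v) \<gamma>" v])
    show "list_join (map (inf v) \<gamma>) = v"
      using v(2) \<gamma>(2) by (simp add: inf_list_join[symmetric] inf.absorb1)
    show "set (map (inf v) \<gamma>) \<subseteq> B"
      using sB v \<gamma>(1) lattice_basis_inf[OF basis] by auto
    show "restr c u v f \<in> Hom C c (omap G v)"
      using c u v sB f(1) by (intro restr_in) auto
    show "k v \<in> Hom C c (omap G v)"
      using k v(1) by (rule family_in)
    fix w' assume "w' \<in> set (map (inf v) \<gamma>)"
    then obtain w where w: "w \<in> set \<gamma>" "w' = inf v w" by auto
    have wu: "w \<le> u" using w(1) \<gamma>(2) list_join_upper by blast
    have ws: "w \<in> sieve \<alpha>" using w(1) \<gamma>(1) by blast
    have w'B: "w' \<in> B" using w(2) sB v(1) ws lattice_basis_inf[OF basis] by blast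
    have w's: "w' \<in> sieve \<alpha>" using sieve_down[OF ws w'B] w(2) by simp
    have "restr c v w' (restr c u v f) = restr c u w' f"
      using c u v sB f(1) w'B w(2) by (intro restr_restr) auto
    also have "\<dots> = restr c w w' (restr c u w f)"
      using c u ws sB f(1) w'B w(2) wu by (intro restr_restr[symmetric]) auto
    also have "\<dots> = k w'"
      using f(2)[OF w(1)] family_restr[OF k ws w's] w(2) by simp
    also have "\<dots> = restr c v w' (k v)"
      using family_restr[OF k v(1) w's] w(2) by simp
    finally show "restr c v w' (restr c u v f) = restr c v w' (k v)" .
  qed (use c sB v in auto)
  then show ?thesis using f(1) by blast
qed

lemma sieve_extend:
  assumes k: "family (sieve \<alpha>) c k"
  obtains m where "family (below (list_join \<alpha>)) c m" "\<And>v. v \<in> sieve \<alpha> \<Longrightarrow> m v = k v"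
proof -
  note c = family_ob[OF k]
  obtain m where m: "\<And>u. u \<in> below (list_join \<alpha>) \<Longrightarrow> m u \<in> Hom C c (omap G u)"
      "\<And>u v. u \<in> below (list_join \<alpha>) \<Longrightarrow> v \<in> sieve \<alpha> \<Longrightarrow> v \<le> u \<Longrightarrow> restr c u v (m u) = k v"
  proof -
    have "\<forall>u\<in>below (list_join \<alpha>). \<exists>f. f \<in> Hom C c (omap G u) \<and>
        (\<forall>v\<in>sieve \<alpha>. v \<le> u \<longrightarrow> restr c u v f = k v)"
      using sieve_glue[OF k] by blast
    from bchoice[OF this] show thesis using that by blast
  qed
  have "restr c u v (m u) = m v"
    if uv: "u \<in> below (list_join \<alpha>)" "v \<in> below (list_join \<alpha>)" "v \<le> u" for u v
  proof (rule sieve_separated[OF c uv(2)])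
    show "restr c u v (m u) \<in> Hom C c (omap G v)"
      using c uv m(1) by (intro restr_in) auto
    fix w assume w: "w \<in> sieve \<alpha>" "w \<le> v"
    have "restr c v w (restr c u v (m u)) = restr c u w (m u)"
      using c uv w m(1) sieve_below by (intro restr_restr) auto
    then show "restr c v w (restr c u v (m u)) = restr c v w (m v)"
      using m(2)[OF uv(1) w(1)] m(2)[OF uv(2) w] order_trans[OF w(2) uv(3)] by simp
  qed (use m uv in auto)
  then have ext: "family (below (list_join \<alpha>)) c m"
    unfolding family_iff using c m(1) by simp
  have "m v = k v" if v: "v \<in> sieve \<alpha>" for v
  proof -
    have "v \<in> below (list_join \<alpha>)" using v sieve_below by blast
    then show ?thesis
      using family_restr[OF ext, of v v] m(2)[of v v] v by simp
  qed
  with ext show thesis using that by blast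
qed

section \<open>The right Kan extension\<close>

abbreviation R :: "'l \<Rightarrow> 'o" where
  "R x \<equiv> omap (Ran C B G) x"

abbreviation Rmap :: "'l \<Rightarrow> 'l \<Rightarrow> 'm" where
  "Rmap x y \<equiv> mmap (Ran C B G) x y ()"

definition leg :: "'l \<Rightarrow> 'l \<Rightarrow> 'm" where
  "leg x = snd (ran_cone C B G x)"

definition comp_leg :: "'o \<Rightarrow> 'l \<Rightarrow> 'm \<Rightarrow> 'l \<Rightarrow> 'm" where
  "comp_leg c x h v = Comp C c (R x) (omap G v) (leg x v) h"

lemma ran_limit: "is_limit_cone (op_cat (poset_cat (below x))) C G (R x) (leg x)"
proof -
  have "\<exists>p. case p of (c, l) \<Rightarrow> is_limit_cone (ran_shape B x) C G c l"
    using limits by auto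
  then have "case ran_cone C B G x of (c, l) \<Rightarrow> is_limit_cone (ran_shape B x) C G c l"
    unfolding ran_cone_def by (rule someI_ex)
  then show ?thesis
    unfolding Ran_def leg_def ran_shape_def by (simp add: case_prod_beta)
qed

lemma R_in: "R x \<in> Ob C"
  and leg_family: "family (below x) (R x) (leg x)"
  using ran_limit[of x] unfolding is_limit_cone_op_poset_iff is_cone_op_poset_iff by blast+

lemma leg_in: "v \<in> below x \<Longrightarrow> leg x v \<in> Hom C (R x) (omap G v)"
  using leg_family by (rule family_in)

lemma factor_ex1:
  "family (below x) c k \<Longrightarrow> \<exists>!h. h \<in> Hom C c (R x) \<and> (\<forall>v\<in>below x. comp_leg c x h v = k v)"
  using ran_limit[of x] unfolding is_limit_cone_op_poset_iff comp_leg_def by blast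

lemma comp_leg_family:
  assumes "c \<in> Ob C" "h \<in> Hom C c (R x)"
  shows "family (below x) c (comp_leg c x h)"
proof -
  have "restr c u v (comp_leg c x h u) = comp_leg c x h v"
    if "u \<in> below x" "v \<in> below x" "v \<le> u" for u v
  proof -
    have "restr c u v (comp_leg c x h u) = Comp C c (R x) (omap G v)
        (Comp C (R x) (omap G u) (omap G v) (mmap G u v ()) (leg x u)) h"
      unfolding restr_def comp_leg_def using that assms
      by (intro comp_assoc[symmetric] R_in omap_in leg_in mmap_in) auto
    also have "Comp C (R x) (omap G u) (omap G v) (mmap G u v ()) (leg x u) = leg x v"
      using family_restr[OF leg_family that] unfolding restr_def .
    finally show ?thesis unfolding comp_leg_def .
  qed
  moreover have "comp_leg c x h v \<in> Hom C c (omap G v)" if "v \<in> below x" for v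
    unfolding comp_leg_def using that assms by (intro comp_in R_in omap_in leg_in) auto
  ultimately show ?thesis unfolding family_iff using assms by simp
qed

lemma hom_eqI:
  assumes "c \<in> Ob C" "h \<in> Hom C c (R x)" "h' \<in> Hom C c (R x)"
    and "\<And>v. v \<in> below x \<Longrightarrow> comp_leg c x h v = comp_leg c x h' v"
  shows "h = h'"
  using factor_ex1[OF comp_leg_family[OF assms(1,3)]] assms by (metis (no_types, lifting))

lemma Rmap_props:
  assumes "y \<le> x"
  shows "Rmap x y \<in> Hom C (R x) (R y) \<and> (\<forall>v\<in>below y. comp_leg (R x) y (Rmap x y) v = leg x v)"
proof -
  have "family (below y) (R x) (leg x)"
    using leg_family by (rule is_cone_op_poset_subset) (use assms in auto)
  from theI'[OF factor_ex1[OF this]] show ?thesis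
    by (simp add: comp_leg_def leg_def Ran_def)
qed

lemma Rmap_in: "y \<le> x \<Longrightarrow> Rmap x y \<in> Hom C (R x) (R y)"
  using Rmap_props by blast

lemma comp_leg_Rmap:
  assumes "y \<le> x" "c \<in> Ob C" "h \<in> Hom C c (R x)" "v \<in> below y"
  shows "comp_leg c y (Comp C c (R x) (R y) (Rmap x y) h) v = comp_leg c x h v"
proof -
  have "comp_leg c y (Comp C c (R x) (R y) (Rmap x y) h) v =
      Comp C c (R x) (omap G v) (Comp C (R x) (R y) (omap G v) (leg y v) (Rmap x y)) h"
    unfolding comp_leg_def using assms
    by (intro comp_assoc[symmetric] R_in omap_in leg_in Rmap_in) auto
  also have "Comp C (R x) (R y) (omap G v) (leg y v) (Rmap x y) = leg x v"
    using Rmap_props[OF assms(1)] assms(4) unfolding comp_leg_def by blast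
  finally show ?thesis unfolding comp_leg_def .
qed

lemma presheaf_Ran: "presheaf C UNIV (Ran C B G)"
  unfolding presheaf_iff
proof (intro conjI ballI impI)
  fix x :: 'l
  have id: "Ident C (R x) \<in> Hom C (R x) (R x)"
    by (rule category_ident_in[OF category R_in])
  show "Rmap x x = Ident C (R x)"
  proof (rule hom_eqI)
    fix v assume v: "v \<in> below x"
    have "comp_leg (R x) x (Ident C (R x)) v = leg x v"
      unfolding comp_leg_def using leg_in[OF v] omap_in[of v] R_in[of x] v
      by (intro category_ident_right[OF category]) auto
    then show "comp_leg (R x) x (Rmap x x) v = comp_leg (R x) x (Ident C (R x)) v"
      using Rmap_props[of x x] v by simp
  qed (use id Rmap_in R_in in auto)
next
  fix x y z :: 'l assume le: "y \<le> x" "z \<le> y"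
  show "Rmap x z = Comp C (R x) (R y) (R z) (Rmap y z) (Rmap x y)"
  proof (rule hom_eqI)
    show "Rmap x z \<in> Hom C (R x) (R z)"
      using le by (intro Rmap_in) auto
    show "Comp C (R x) (R y) (R z) (Rmap y z) (Rmap x y) \<in> Hom C (R x) (R z)"
      using le by (intro comp_in R_in Rmap_in)
    fix v assume v: "v \<in> below z"
    have "comp_leg (R x) z (Comp C (R x) (R y) (R z) (Rmap y z) (Rmap x y)) v =
        comp_leg (R x) y (Rmap x y) v"
      using le v by (intro comp_leg_Rmap R_in Rmap_in)
    then show "comp_leg (R x) z (Rmap x z) v =
        comp_leg (R x) z (Comp C (R x) (R y) (R z) (Rmap y z) (Rmap x y)) v"
      using Rmap_props[of z x] Rmap_props[of y x] le v by auto
  qed (rule R_in)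
qed (auto intro: R_in Rmap_in)

lemma cone_sheaf_diagram_Ran_iff:
  "is_cone (sheaf_shape (length \<alpha>)) C (sheaf_diagram (Ran C B G) \<alpha>) c l \<longleftrightarrow>
    c \<in> Ob C \<and>
    (\<forall>i<length \<alpha>. l (Single i) \<in> Hom C c (R (\<alpha> ! i))) \<and>
    (\<forall>i j. i < j \<longrightarrow> j < length \<alpha> \<longrightarrow>
      Comp C c (R (\<alpha> ! i)) (R (inf (\<alpha> ! i) (\<alpha> ! j)))
        (Rmap (\<alpha> ! i) (inf (\<alpha> ! i) (\<alpha> ! j))) (l (Single i)) = l (Overlap i j) \<and>
      Comp C c (R (\<alpha> ! j)) (R (inf (\<alpha> ! i) (\<alpha> ! j)))
        (Rmap (\<alpha> ! j) (inf (\<alpha> ! i) (\<alpha> ! j))) (l (Single j)) = l (Overlap i j))"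
  by (rule is_cone_sheaf_diagram_iff[OF presheaf_Ran category]) auto

lemma Rmap_comp:
  "y \<le> x \<Longrightarrow> z \<le> y \<Longrightarrow> c \<in> Ob C \<Longrightarrow> h \<in> Hom C c (R x) \<Longrightarrow>
    Comp C c (R y) (R z) (Rmap y z) (Comp C c (R x) (R y) (Rmap x y) h) =
    Comp C c (R x) (R z) (Rmap x z) h"
  using presheaf_mmap_trans[OF presheaf_Ran, of x y z] R_in Rmap_in
    comp_assoc[of c "R x" "R y" "R z" h "Rmap x y" "Rmap y z"]
  by simp

lemma Ran_cone_family:
  assumes "is_cone (sheaf_shape (length \<alpha>)) C (sheaf_diagram (Ran C B G) \<alpha>) c l"
  obtains k where "family (sieve \<alpha>) c k"
    "\<And>i v. i < length \<alpha> \<Longrightarrow> v \<in> below (\<alpha> ! i) \<Longrightarrow> comp_leg c (\<alpha> ! i) (l (Single i)) v = k v"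
proof -
  note cone = assms[unfolded cone_sheaf_diagram_Ran_iff]
  let ?k = "\<lambda>i. comp_leg c (\<alpha> ! i) (l (Single i))"
  have agree_less: "?k i v = ?k j v"
    if "i < j" "j < length \<alpha>" "v \<in> below (\<alpha> ! i)" "v \<in> below (\<alpha> ! j)" for i j v
  proof -
    let ?w = "inf (\<alpha> ! i) (\<alpha> ! j)"
    have v: "v \<in> below ?w" using that by simp
    have "?k i v = comp_leg c ?w (l (Overlap i j)) v"
      using comp_leg_Rmap[of ?w "\<alpha> ! i" c "l (Single i)" v] that v cone by simp
    also have "\<dots> = ?k j v"
      using comp_leg_Rmap[of ?w "\<alpha> ! j" c "l (Single j)" v] that v cone by simp
    finally show ?thesis .
  qed
  have agree: "?k i v = ?k j v"
    if "i < length \<alpha>" "j < length \<alpha>" "v \<in> below (\<alpha> ! i)" "v \<in> below (\<alpha> ! j)" for i j v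
  proof (cases i j rule: linorder_cases)
    case less
    then show ?thesis using that by (intro agree_less)
  next
    case greater
    then show ?thesis using that by (intro agree_less[symmetric])
  qed simp
  define k where "k v = ?k (SOME i. i < length \<alpha> \<and> v \<le> \<alpha> ! i) v" for v
  have k: "?k i v = k v" if "i < length \<alpha>" "v \<in> below (\<alpha> ! i)" for i v
  proof -
    have "\<exists>i. i < length \<alpha> \<and> v \<le> \<alpha> ! i" using that by blast
    from someI_ex[OF this] show ?thesis
      unfolding k_def using that by (intro agree) auto
  qed
  have fam: "family (below (\<alpha> ! i)) c (?k i)" if "i < length \<alpha>" for i
    using cone that by (intro comp_leg_family) simp_all
  have idx: "\<exists>i<length \<alpha>. u \<in> below (\<alpha> ! i)" if "u \<in> sieve \<alpha>" for u
    using that unfolding sieve_def by (auto simp: in_set_conv_nth)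
  have "family (sieve \<alpha>) c k"
    unfolding family_iff
  proof (intro conjI ballI impI)
    show "c \<in> Ob C" using cone by simp
    show "k v \<in> Hom C c (omap G v)" if "v \<in> sieve \<alpha>" for v
      using idx[OF that] family_in[OF fam] k by metis
    fix u v assume uv: "u \<in> sieve \<alpha>" "v \<in> sieve \<alpha>" "v \<le> u"
    obtain i where i: "i < length \<alpha>" "u \<in> below (\<alpha> ! i)" using idx[OF uv(1)] by blast
    have v: "v \<in> below (\<alpha> ! i)" using i uv unfolding sieve_def by auto
    show "restr c u v (k u) = k v"
      using family_restr[OF fam[OF i(1)] i(2) v uv(3)] k[OF i] k[OF i(1) v] by simp
  qed
  then show thesis using k that by blast
qed

lemma sheaf_Ran: "sheaf_on C UNIV (Ran C B G)"
  unfolding sheaf_on_def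
proof (intro conjI allI impI)
  fix \<alpha> :: "'l list"
  let ?x = "list_join \<alpha>" and ?J = "sheaf_shape (length \<alpha>)"
  let ?D = "sheaf_diagram (Ran C B G) \<alpha>" and ?r = "\<lambda>p. Rmap (list_join \<alpha>) (sheaf_elem \<alpha> p)"
  have up: "\<alpha> ! i \<le> ?x" if "i < length \<alpha>" for i
    using that by (simp add: list_join_upper)
  show "is_limit_cone ?J C ?D (R ?x) ?r"
    unfolding is_limit_cone_def
  proof (intro conjI allI impI)
    have "Comp C (R ?x) (R (\<alpha> ! i)) (R z) (Rmap (\<alpha> ! i) z) (Rmap ?x (\<alpha> ! i)) = Rmap ?x z"
      if "i < length \<alpha>" "z \<le> \<alpha> ! i" for i z
      using presheaf_mmap_trans[OF presheaf_Ran, of ?x "\<alpha> ! i" z] up[OF that(1)] that(2) by simp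
    then show "is_cone ?J C ?D (R ?x) ?r"
      unfolding cone_sheaf_diagram_Ran_iff by (auto intro: R_in Rmap_in up)
  next
    fix c l assume l: "is_cone ?J C ?D c l"
    note cone = l[unfolded cone_sheaf_diagram_Ran_iff]
    have c: "c \<in> Ob C" using cone by simp
    obtain k where k: "family (sieve \<alpha>) c k"
      "\<And>i v. i < length \<alpha> \<Longrightarrow> v \<in> below (\<alpha> ! i) \<Longrightarrow> comp_leg c (\<alpha> ! i) (l (Single i)) v = k v"
      using Ran_cone_family[OF l] by blast
    obtain m where m: "family (below ?x) c m" "\<And>v. v \<in> sieve \<alpha> \<Longrightarrow> m v = k v"
      using sieve_extend[OF k(1)] by blast
    have belowI: "v \<in> below ?x" "v \<in> sieve \<alpha>" if "i < length \<alpha>" "v \<in> below (\<alpha> ! i)" for i v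
      using that up[OF that(1)] unfolding sieve_def by (auto intro: order_trans)
    obtain h where h: "h \<in> Hom C c (R ?x)" "\<And>v. v \<in> below ?x \<Longrightarrow> comp_leg c ?x h v = m v"
      using factor_ex1[OF m(1)] by blast
    have single: "Comp C c (R ?x) (R (\<alpha> ! i)) (Rmap ?x (\<alpha> ! i)) h = l (Single i)"
      if i: "i < length \<alpha>" for i
    proof (rule hom_eqI[OF c])
      show "Comp C c (R ?x) (R (\<alpha> ! i)) (Rmap ?x (\<alpha> ! i)) h \<in> Hom C c (R (\<alpha> ! i))"
        using c h(1) up[OF i] by (intro comp_in R_in Rmap_in)
      show "l (Single i) \<in> Hom C c (R (\<alpha> ! i))" using cone i by simp
      fix v assume v: "v \<in> below (\<alpha> ! i)"
      show "comp_leg c (\<alpha> ! i) (Comp C c (R ?x) (R (\<alpha> ! i)) (Rmap ?x (\<alpha> ! i)) h) v =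
          comp_leg c (\<alpha> ! i) (l (Single i)) v"
        using comp_leg_Rmap[OF up[OF i] c h(1) v] h(2) m(2) k(2)[OF i v] belowI[OF i v] by simp
    qed
    have overlap: "Comp C c (R ?x) (R (inf (\<alpha> ! i) (\<alpha> ! j)))
        (Rmap ?x (inf (\<alpha> ! i) (\<alpha> ! j))) h = l (Overlap i j)"
      if "i < j" "j < length \<alpha>" for i j
      using Rmap_comp[of "\<alpha> ! i" ?x "inf (\<alpha> ! i) (\<alpha> ! j)" c h] up[of i] c h(1) single[of i] cone that
      by simp
    show "\<exists>!h. h \<in> Hom C c (R ?x) \<and>
        (\<forall>p\<in>Ob ?J. Comp C c (R ?x) (omap ?D p) (?r p) h = l p)"
    proof (intro ex1I conjI)
      show "\<forall>p\<in>Ob ?J. Comp C c (R ?x) (omap ?D p) (?r p) h = l p"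
        unfolding ball_Ob_sheaf_shape using single overlap by (simp add: sheaf_diagram_def)
    next
      fix h' assume h': "h' \<in> Hom C c (R ?x) \<and>
        (\<forall>p\<in>Ob ?J. Comp C c (R ?x) (omap ?D p) (?r p) h' = l p)"
      then have single': "Comp C c (R ?x) (R (\<alpha> ! i)) (Rmap ?x (\<alpha> ! i)) h' = l (Single i)"
        if "i < length \<alpha>" for i
        using that unfolding ball_Ob_sheaf_shape by (simp add: sheaf_diagram_def)
      have fam: "family (below ?x) c (comp_leg c ?x h')"
        using comp_leg_family c h' by blast
      have leg_sieve: "comp_leg c ?x h' v = m v" if "v \<in> sieve \<alpha>" for v
      proof -
        obtain i where i: "i < length \<alpha>" "v \<in> below (\<alpha> ! i)"
          using \<open>v \<in> sieve \<alpha>\<close> unfolding sieve_def by (auto simp: in_set_conv_nth)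
        have "comp_leg c ?x h' v = comp_leg c (\<alpha> ! i) (l (Single i)) v"
          using comp_leg_Rmap[OF up[OF i(1)] c _ i(2), of h'] h' single'[OF i(1)] by simp
        then show ?thesis using k(2)[OF i] m(2)[OF that] by simp
      qed
      have "comp_leg c ?x h' u = m u" if u: "u \<in> below ?x" for u
      proof (rule sieve_separated[OF c u])
        fix v assume v: "v \<in> sieve \<alpha>" "v \<le> u"
        then have "v \<in> below ?x" using sieve_below by blast
        then show "restr c u v (comp_leg c ?x h' u) = restr c u v (m u)"
          using family_restr[OF fam u _ v(2)] family_restr[OF m(1) u _ v(2)] leg_sieve[OF v(1)]
          by simp
      qed (rule family_in[OF fam u] family_in[OF m(1) u])+
      then show "h' = h"
        using h h' by (intro hom_eqI[OF c, of h' ?x h]) simp_all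
    qed (rule h(1))
  qed
qed (rule presheaf_Ran)

end

theorem theorem1:
  fixes C :: "('o, 'm) cat"
    and B :: "'l::{distrib_lattice, bounded_lattice} set"
    and G :: "('l, unit, 'o, 'm) cfunctor"
    and e :: "'l \<Rightarrow> 'u"
  assumes "inj e"
    and "lattice_basis B"
    and "category C"
    and "complete_category TYPE('u) C"
    and "sheaf_on_basis C B G"
  shows "sheaf_on_lattice C (Ran C B G)"
proof -
  have sheaf: "sheaf_on C B G"
    using assms(5) unfolding sheaf_on_basis_def .
  have "\<exists>c l. is_limit_cone (ran_shape B x) C G c l" for x
    unfolding ran_shape_def
  proof (rule complete_category_op_poset_limit[OF assms(1,4)])
    show "presheaf C {u \<in> B. u \<le> x} G"
      by (rule presheaf_subset[of C B]) (use sheaf in \<open>auto simp: sheaf_on_def\<close>)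
  qed
  then interpret basis_sheaf C B G
    using assms(2,3) sheaf by unfold_locales
  show ?thesis
    unfolding sheaf_on_lattice_def by (rule sheaf_Ran)
qed

end
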